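(* Let $t=(t_j)_{j\ge1}$ be a decreasing sequence of real numbers with $0<t_j<1$ for all $j$. Then for every positive integer $N$, $$\Lambda_t(N)\le (e^2+1)\,([\log N]+2)\,\max_{1\le n\le N}\Gamma_t(n).$$
   Context: A multi-index is a sequence $\beta=(\beta^{(1)},\beta^{(2)},\dots)$ of nonnegative integers with only finitely many nonzero entries. For multi-indices $\beta,\mu$, $|\beta-\mu|$ denotes the multi-index $(|\beta^{(j)}-\mu^{(j)}|)_j$. For a sequence $t=(t_j)$ and a multi-index $\beta$, $t^\beta:=\prod_j t_j^{\beta^{(j)}}$. Define $$\Gamma_t(n):=\sup_{\beta_1,\dots,\beta_n}\frac1n\sum_{k,\ell=1}^n t^{|\beta_k-\beta_\ell|},\qquad \Lambda_t(N):=\sup_{\beta_1,\dots,\beta_N}\ \sup_{c\ne0}\ \frac{\sum_{k,\ell=1}^N t^{|\beta_k-\beta_\ell|}c_k\overline{c_\ell}}{\sum_{j=1}^N|c_j|^2},$$ where the suprema over $\beta$'s are over all $n$-tuples, respectively $N$-tuples, of distinct multi-indices, and $c=(c_1,\dots,c_N)$ ranges over nonzero vectors in $\mathbb{C}^N$. $[x]$ is the integer part of $x$ and $\log$ is the natural logarithm. *)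

theory Defs
  imports Complex_Main "HOL-Library.Poly_Mapping"
begin

(* The coordinates of multi-indices, like the entries of t, are numbered from 0. *)
type_synonym multi_index = "nat \<Rightarrow>\<^sub>0 nat"

lift_definition absdiff :: "multi_index \<Rightarrow> multi_index \<Rightarrow> multi_index"
  is "\<lambda>\<beta> \<mu> j. nat \<bar>int (\<beta> j) - int (\<mu> j)\<bar>"
proof -
  fix \<beta> \<mu> :: "nat \<Rightarrow> nat"
  assume "finite {j. \<beta> j \<noteq> 0}" "finite {j. \<mu> j \<noteq> 0}"
  then have "finite ({j. \<beta> j \<noteq> 0} \<union> {j. \<mu> j \<noteq> 0})"
    by simp
  then show "finite {j. nat \<bar>int (\<beta> j) - int (\<mu> j)\<bar> \<noteq> 0}"
    by (rule rev_finite_subset) auto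
qed

(* Outside the support the factors t j ^ 0 are 1. *)
definition mpow :: "(nat \<Rightarrow> real) \<Rightarrow> multi_index \<Rightarrow> real" where
  "mpow t \<beta> = (\<Prod>j\<in>Poly_Mapping.keys \<beta>. t j ^ Poly_Mapping.lookup \<beta> j)"

(* Only the values at 1, ..., n of the functions below matter. *)
definition distinct_tuples :: "nat \<Rightarrow> (nat \<Rightarrow> multi_index) set" where
  "distinct_tuples n = {\<beta>. inj_on \<beta> {1..n}}"

definition nonzero_vectors :: "nat \<Rightarrow> (nat \<Rightarrow> complex) set" where
  "nonzero_vectors n = {c. \<exists>k\<in>{1..n}. c k \<noteq> 0}"

definition Gam :: "(nat \<Rightarrow> real) \<Rightarrow> nat \<Rightarrow> real" where
  "Gam t n = (SUP \<beta>\<in>distinct_tuples n.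
     (1 / real n) * (\<Sum>k=1..n. \<Sum>l=1..n. mpow t (absdiff (\<beta> k) (\<beta> l))))"

(* The matrix is real and symmetric, so the Hermitian form is real-valued
   (see Hermitian_form_real below) and Re only adjusts the type. *)
definition Lam :: "(nat \<Rightarrow> real) \<Rightarrow> nat \<Rightarrow> real" where
  "Lam t N = (SUP \<beta>\<in>distinct_tuples N. SUP c\<in>nonzero_vectors N.
     Re (\<Sum>k=1..N. \<Sum>l=1..N. complex_of_real (mpow t (absdiff (\<beta> k) (\<beta> l))) * c k * cnj (c l))
       / (\<Sum>j=1..N. (cmod (c j))\<^sup>2))"

lemma absdiff_commute: "absdiff \<beta> \<mu> = absdiff \<mu> \<beta>"
  by transfer (simp add: abs_minus_commute)

lemma Hermitian_form_real:
  "(\<Sum>k=1..N. \<Sum>l=1..N. complex_of_real (mpow t (absdiff (\<beta> k) (\<beta> l))) * c k * cnj (c l)) \<in> \<real>"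
  (is "?S \<in> \<real>")
proof -
  have "cnj ?S = (\<Sum>k=1..N. \<Sum>l=1..N. complex_of_real (mpow t (absdiff (\<beta> l) (\<beta> k))) * c l * cnj (c k))"
    by (simp add: absdiff_commute mult_ac)
  also have "\<dots> = ?S"
    by (rule sum.swap)
  finally show ?thesis
    by (simp add: Reals_cnj_iff)
qed

lemma mpow_bounds:
  assumes "\<And>j. 0 < t j \<and> t j < 1"
  shows "0 \<le> mpow t \<beta>" "mpow t \<beta> \<le> 1"
  unfolding mpow_def using assms
  by (auto intro!: prod_nonneg prod_le_1 power_le_one simp: less_imp_le)

(* For 0 < t j < 1 all suprema above are over nonempty sets bounded above,
   so the real-valued SUP is the true supremum. *)
lemma distinct_tuples_nonempty: "distinct_tuples n \<noteq> {}"
proof -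
  have "inj (\<lambda>k::nat. Poly_Mapping.single (0::nat) k)"
    by (metis injI lookup_single_eq)
  then show ?thesis
    unfolding distinct_tuples_def by (blast intro: inj_on_subset)
qed

lemma nonzero_vectors_nonempty:
  assumes "n \<ge> 1"
  shows "nonzero_vectors n \<noteq> {}"
proof -
  have "(\<lambda>_. 1) \<in> nonzero_vectors n"
    unfolding nonzero_vectors_def using assms by force
  then show ?thesis by blast
qed

lemma Gam_quotient_le:
  assumes "\<And>j. 0 < t j \<and> t j < 1"
  shows "(1 / real n) * (\<Sum>k=1..n. \<Sum>l=1..n. mpow t (absdiff (\<beta> k) (\<beta> l))) \<le> real n"
proof -
  have "(\<Sum>k=1..n. \<Sum>l=1..n. mpow t (absdiff (\<beta> k) (\<beta> l))) \<le> (\<Sum>k=1..n. \<Sum>l=1..n. 1)"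
    by (intro sum_mono mpow_bounds assms)
  then show ?thesis
    by (cases "n = 0") (simp_all add: divide_le_eq)
qed

lemma Lam_quotient_le:
  assumes "\<And>j. 0 < t j \<and> t j < 1"
  shows "Re (\<Sum>k=1..N. \<Sum>l=1..N. complex_of_real (mpow t (absdiff (\<beta> k) (\<beta> l))) * c k * cnj (c l))
       / (\<Sum>j=1..N. (cmod (c j))\<^sup>2) \<le> real N"
proof -
  let ?S = "\<Sum>k=1..N. \<Sum>l=1..N. complex_of_real (mpow t (absdiff (\<beta> k) (\<beta> l))) * c k * cnj (c l)"
  let ?D = "\<Sum>j=1..N. (cmod (c j))\<^sup>2"
  have entry: "cmod (complex_of_real (mpow t (absdiff (\<beta> k) (\<beta> l))) * c k * cnj (c l))
      \<le> ((cmod (c k))\<^sup>2 + (cmod (c l))\<^sup>2) / 2" for k l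
  proof -
    have "cmod (complex_of_real (mpow t (absdiff (\<beta> k) (\<beta> l))) * c k * cnj (c l))
        = mpow t (absdiff (\<beta> k) (\<beta> l)) * (cmod (c k) * cmod (c l))"
      by (simp add: norm_mult mpow_bounds[OF assms])
    also have "\<dots> \<le> 1 * (cmod (c k) * cmod (c l))"
      by (intro mult_right_mono mpow_bounds assms) simp
    also have "\<dots> \<le> ((cmod (c k))\<^sup>2 + (cmod (c l))\<^sup>2) / 2"
      using sum_squares_bound[of "cmod (c k)" "cmod (c l)"] by simp
    finally show ?thesis .
  qed
  have "Re ?S \<le> cmod ?S"
    by (rule complex_Re_le_cmod)
  also have "\<dots> \<le> (\<Sum>k=1..N. \<Sum>l=1..N. ((cmod (c k))\<^sup>2 + (cmod (c l))\<^sup>2) / 2)"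
    by (intro sum_norm_le entry)
  also have "\<dots> = real N * ?D"
    by (simp add: sum.distrib flip: sum_divide_distrib sum_distrib_left)
  finally have "Re ?S \<le> real N * ?D" .
  moreover have "?D \<ge> 0"
    by (simp add: sum_nonneg)
  ultimately show ?thesis
    by (cases "?D = 0") (simp_all add: divide_le_eq)
qed

end

(* Splitting a nonnegative vector c into the level sets
   exp (-(i+1)) |c| < c x <= exp (-i) |c| for i <= [log N], and the remaining entries, gives
   [log N] + 2 blocks. On each of them c is constant up to a factor e, so the form
   restricted to the block is controlled by Gamma. The cross terms cost only a factor equal
   to the number of blocks, because the kernel is positive semidefinite: it is a
   product of the kernels r ^ |a - b|, which are explicit Gram kernels. *)
theory Submission
  imports Defs
begin

section \<open>Bilinear forms and positive semidefinite kernels\<close>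

definition bform :: "'a set \<Rightarrow> ('a \<Rightarrow> 'a \<Rightarrow> real) \<Rightarrow> ('a \<Rightarrow> real) \<Rightarrow> ('a \<Rightarrow> real) \<Rightarrow> real" where
  "bform S K u v = (\<Sum>x\<in>S. \<Sum>y\<in>S. K x y * u x * v y)"

definition psd_on :: "'a set \<Rightarrow> ('a \<Rightarrow> 'a \<Rightarrow> real) \<Rightarrow> bool" where
  "psd_on S K \<longleftrightarrow> (\<forall>c. 0 \<le> bform S K c c)"

lemma psd_on_one: "psd_on S (\<lambda>_ _. 1)"
proof -
  have "bform S (\<lambda>_ _. 1) c c = (\<Sum>x\<in>S. c x)\<^sup>2" for c
    by (simp add: bform_def power2_eq_square sum_product)
  then show ?thesis
    by (simp add: psd_on_def)
qed

text \<open>The easy case of the Schur product theorem: expanding the Gram factor turns the form of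
  the product at \<open>c\<close> into a sum over \<open>i\<close> of forms of \<open>K\<close> at
  the vectors \<open>g i x * c x\<close>, each nonnegative.\<close>

lemma psd_on_times_gram:
  assumes "psd_on S K"
    and gram: "\<And>x y. x \<in> S \<Longrightarrow> y \<in> S \<Longrightarrow> L x y = (\<Sum>i\<in>I. g i x * g i y)"
  shows "psd_on S (\<lambda>x y. L x y * K x y)"
  unfolding psd_on_def
proof
  fix c
  have "bform S (\<lambda>x y. L x y * K x y) c c
      = (\<Sum>x\<in>S. \<Sum>y\<in>S. \<Sum>i\<in>I. K x y * (g i x * c x) * (g i y * c y))"
    unfolding bform_def by (intro sum.cong) (simp_all add: gram sum_distrib_left sum_distrib_right mult_ac)
  also have "\<dots> = (\<Sum>x\<in>S. \<Sum>i\<in>I. \<Sum>y\<in>S. K x y * (g i x * c x) * (g i y * c y))"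
    by (intro sum.cong refl sum.swap)
  also have "\<dots> = (\<Sum>i\<in>I. bform S K (\<lambda>x. g i x * c x) (\<lambda>x. g i x * c x))"
    unfolding bform_def by (rule sum.swap)
  also have "\<dots> \<ge> 0"
    using assms(1) by (simp add: psd_on_def sum_nonneg)
  finally show "0 \<le> bform S (\<lambda>x y. L x y * K x y) c c" .
qed

section \<open>Gram vectors for the kernel \<open>r ^ |m - n|\<close>\<close>

text \<open>The vectors are those of a stationary autoregressive process:
  $x_0 = e_0$ and $x_{m+1} = r x_m + \sqrt{1 - r^2}\, e_{m+1}$.\<close>

definition ar_vector :: "real \<Rightarrow> nat \<Rightarrow> nat \<Rightarrow> real" where
  "ar_vector r i m = (if i \<le> m then r ^ (m - i) * (if i = 0 then 1 else sqrt (1 - r\<^sup>2)) else 0)"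

lemma ar_vector_Suc:
  "ar_vector r i (Suc m) = (if i = Suc m then sqrt (1 - r\<^sup>2) else r * ar_vector r i m)"
  by (auto simp: ar_vector_def Suc_diff_le)

lemma ar_vector_eq_0: "m < i \<Longrightarrow> ar_vector r i m = 0"
  by (simp add: ar_vector_def)

text \<open>Stationarity: multiplication by \<open>r\<close> shrinks the squared norm to
  \<open>r^2\<close>, and the new coordinate, orthogonal to the old ones, adds back
  \<open>1 - r^2\<close>.\<close>

lemma ar_vector_gram_diag:
  assumes "r\<^sup>2 \<le> 1"
  shows "(\<Sum>i\<le>m. (ar_vector r i m)\<^sup>2) = 1"
proof (induction m)
  case 0
  then show ?case by (simp add: ar_vector_def)
next
  case (Suc m)
  have "(\<Sum>i\<le>Suc m. (ar_vector r i (Suc m))\<^sup>2) = r\<^sup>2 * (\<Sum>i\<le>m. (ar_vector r i m)\<^sup>2) + (1 - r\<^sup>2)"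
    using assms by (simp add: ar_vector_Suc power_mult_distrib sum_distrib_left)
  then show ?case using Suc.IH by simp
qed

text \<open>Coordinates introduced after time \<open>m\<close> are orthogonal to the vector at time
  \<open>m\<close>, so each later time step just multiplies the inner product by
  \<open>r\<close>.\<close>

lemma ar_vector_gram_le:
  assumes "r\<^sup>2 \<le> 1"
  shows "(\<Sum>i\<le>m. ar_vector r i m * ar_vector r i (m + d)) = r ^ d"
proof (induction d)
  case 0
  then show ?case using ar_vector_gram_diag[OF assms, of m] by (simp add: power2_eq_square)
next
  case (Suc d)
  have "(\<Sum>i\<le>m. ar_vector r i m * ar_vector r i (m + Suc d))
      = (\<Sum>i\<le>m. r * (ar_vector r i m * ar_vector r i (m + d)))"
    by (intro sum.cong) (simp_all add: ar_vector_Suc)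
  then show ?case using Suc.IH by (simp flip: sum_distrib_left)
qed

text \<open>The common range up to \<open>M\<close> lets one finite index set serve all pairs; the
  coordinates beyond the smaller of \<open>m\<close> and \<open>n\<close> contribute
  nothing.\<close>

lemma ar_vector_gram:
  assumes "r\<^sup>2 \<le> 1" "m \<le> M" "n \<le> M"
  shows "(\<Sum>i\<le>M. ar_vector r i m * ar_vector r i n) = r ^ nat \<bar>int m - int n\<bar>"
proof -
  have *: "(\<Sum>i\<le>M. ar_vector r i m * ar_vector r i n) = r ^ nat \<bar>int m - int n\<bar>"
    if "m \<le> n" "m \<le> M" for m n
  proof -
    have "(\<Sum>i\<le>M. ar_vector r i m * ar_vector r i n) = (\<Sum>i\<le>m. ar_vector r i m * ar_vector r i n)"
      using that by (intro sum.mono_neutral_right) (auto simp: ar_vector_eq_0)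
    also have "\<dots> = r ^ (n - m)"
      using ar_vector_gram_le[OF assms(1), of m "n - m"] that by simp
    also have "n - m = nat \<bar>int m - int n\<bar>"
      using that by simp
    finally show ?thesis .
  qed
  show ?thesis
  proof (cases "m \<le> n")
    case False
    then show ?thesis
      using *[of n m] assms by (simp add: mult.commute abs_minus_commute)
  qed (use * assms in simp)
qed

section \<open>Positive semidefiniteness of the multi-index kernel\<close>

text \<open>All multi-indices over \<open>S\<close> are supported in one finite set
  \<open>J\<close>, so the kernel is a product over \<open>J\<close> of one-variable kernels.
  Induction on \<open>J\<close> multiplies in one Gram kernel at a time, starting from the constant
  kernel 1.\<close>

lemma psd_on_mpow_absdiff:
  assumes t: "\<And>j. 0 < t j \<and> t j < 1" and "finite S"
  shows "psd_on S (\<lambda>x y. mpow t (absdiff (\<beta> x) (\<beta> y)))"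
proof -
  define J where "J = (\<Union>x\<in>S. Poly_Mapping.keys (\<beta> x))"
  define k where "k = (\<lambda>j x. Poly_Mapping.lookup (\<beta> x) j)"
  have "finite J"
    using \<open>finite S\<close> by (simp add: J_def)
  have mpow: "mpow t (absdiff (\<beta> x) (\<beta> y)) = (\<Prod>j\<in>J. t j ^ nat \<bar>int (k j x) - int (k j y)\<bar>)"
    if "x \<in> S" "y \<in> S" for x y
  proof -
    have lookup: "Poly_Mapping.lookup (absdiff (\<beta> x) (\<beta> y)) j = nat \<bar>int (k j x) - int (k j y)\<bar>" for j
      by (simp add: k_def absdiff.rep_eq)
    have "Poly_Mapping.keys (absdiff (\<beta> x) (\<beta> y)) \<subseteq> J"
    proof
      fix j assume "j \<in> Poly_Mapping.keys (absdiff (\<beta> x) (\<beta> y))"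
      then have "k j x \<noteq> k j y"
        by (auto simp: in_keys_iff lookup)
      then have "k j x \<noteq> 0 \<or> k j y \<noteq> 0"
        by auto
      then show "j \<in> J"
        using that by (auto simp: J_def k_def in_keys_iff)
    qed
    then show ?thesis
      unfolding mpow_def using \<open>finite J\<close>
      by (subst prod.mono_neutral_left[where T = J]) (auto simp: in_keys_iff lookup)
  qed
  have "psd_on S (\<lambda>x y. \<Prod>j\<in>J. t j ^ nat \<bar>int (k j x) - int (k j y)\<bar>)"
    using \<open>finite J\<close>
  proof (induction J rule: finite_induct)
    case empty
    then show ?case by (simp add: psd_on_one)
  next
    case (insert j J)
    define M where "M = Max (k j ` S)"
    have "k j x \<le> M" if "x \<in> S" for x
      using \<open>finite S\<close> that by (simp add: M_def)
    moreover have "(t j)\<^sup>2 \<le> 1"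
      using t[of j] by (simp add: power_le_one)
    ultimately have "psd_on S (\<lambda>x y. t j ^ nat \<bar>int (k j x) - int (k j y)\<bar>
        * (\<Prod>j\<in>J. t j ^ nat \<bar>int (k j x) - int (k j y)\<bar>))"
      by (intro psd_on_times_gram[OF insert.IH, where I = "{..M}" and g = "\<lambda>i x. ar_vector (t j) i (k j x)"])
        (simp add: ar_vector_gram)
    then show ?case
      using insert.hyps by simp
  qed
  then show ?thesis
    by (simp add: psd_on_def bform_def mpow)
qed

section \<open>Decomposition of a vector into blocks\<close>

lemma bform_sum:
  "bform S K (\<lambda>x. \<Sum>i\<in>I. v i x) (\<lambda>x. \<Sum>j\<in>J. w j x) = (\<Sum>i\<in>I. \<Sum>j\<in>J. bform S K (v i) (w j))"
proof -
  have "bform S K (\<lambda>x. \<Sum>i\<in>I. v i x) (\<lambda>x. \<Sum>j\<in>J. w j x)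
      = (\<Sum>x\<in>S. \<Sum>y\<in>S. \<Sum>i\<in>I. \<Sum>j\<in>J. K x y * v i x * w j y)"
    by (simp add: bform_def sum_distrib_left sum_distrib_right sum.swap[of _ J])
  also have "\<dots> = (\<Sum>x\<in>S. \<Sum>i\<in>I. \<Sum>y\<in>S. \<Sum>j\<in>J. K x y * v i x * w j y)"
    by (intro sum.cong refl sum.swap)
  also have "\<dots> = (\<Sum>x\<in>S. \<Sum>i\<in>I. \<Sum>j\<in>J. \<Sum>y\<in>S. K x y * v i x * w j y)"
    by (intro sum.cong refl sum.swap)
  also have "\<dots> = (\<Sum>i\<in>I. \<Sum>x\<in>S. \<Sum>j\<in>J. \<Sum>y\<in>S. K x y * v i x * w j y)"
    by (rule sum.swap)
  also have "\<dots> = (\<Sum>i\<in>I. \<Sum>j\<in>J. bform S K (v i) (w j))"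
    unfolding bform_def by (intro sum.cong refl sum.swap)
  finally show ?thesis .
qed

text \<open>Cauchy-Schwarz for a sum of \<open>card I\<close> vectors: this is where
  semidefiniteness limits the cost of the cross terms to the number of blocks.\<close>

lemma psd_on_bform_sum_le:
  assumes "psd_on S K"
  shows "bform S K (\<lambda>x. \<Sum>i\<in>I. v i x) (\<lambda>x. \<Sum>i\<in>I. v i x)
    \<le> real (card I) * (\<Sum>i\<in>I. bform S K (v i) (v i))"
proof -
  let ?B = "bform S K"
  \<comment> \<open>Summing the nonnegative forms of all differences gives twice the right-hand side
    minus twice the left-hand side of the claim.\<close>
  have "0 \<le> (\<Sum>i\<in>I. \<Sum>j\<in>I. ?B (\<lambda>x. v i x - v j x) (\<lambda>x. v i x - v j x))"
    using assms by (simp add: psd_on_def sum_nonneg)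
  also have "\<dots> = (\<Sum>i\<in>I. \<Sum>j\<in>I. ?B (v i) (v i) + ?B (v j) (v j) - (?B (v i) (v j) + ?B (v j) (v i)))"
    by (intro sum.cong refl)
      (simp add: bform_def algebra_simps sum.distrib sum_subtractf)
  also have "\<dots> = 2 * (real (card I) * (\<Sum>i\<in>I. ?B (v i) (v i))) - 2 * (\<Sum>i\<in>I. \<Sum>j\<in>I. ?B (v i) (v j))"
    using sum.swap[of "\<lambda>i j. ?B (v i) (v j)" I I]
    by (simp add: sum.distrib sum_subtractf sum_distrib_left)
  finally show ?thesis
    by (simp add: bform_sum)
qed

text \<open>As the kernel is nonnegative on \<open>T\<close>, replacing every entry by the bound
  \<open>M\<close> can only increase the form, which leaves \<open>M^2\<close> times the plain
  kernel sum.\<close>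

lemma bform_restrict_le:
  assumes "finite S" "T \<subseteq> S"
    and K: "\<And>x y. x \<in> T \<Longrightarrow> y \<in> T \<Longrightarrow> 0 \<le> K x y"
    and c: "\<And>x. x \<in> T \<Longrightarrow> 0 \<le> c x \<and> c x \<le> M"
    and G: "(\<Sum>x\<in>T. \<Sum>y\<in>T. K x y) \<le> real (card T) * G"
  shows "bform S K (\<lambda>x. if x \<in> T then c x else 0) (\<lambda>x. if x \<in> T then c x else 0)
    \<le> M\<^sup>2 * real (card T) * G"
proof -
  have "bform S K (\<lambda>x. if x \<in> T then c x else 0) (\<lambda>x. if x \<in> T then c x else 0)
      = (\<Sum>x\<in>T. \<Sum>y\<in>T. K x y * c x * c y)"
    unfolding bform_def using assms(1,2)
    by (intro sum.mono_neutral_cong_right) (auto intro!: sum.mono_neutral_cong_right)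
  also have "\<dots> \<le> (\<Sum>x\<in>T. \<Sum>y\<in>T. M\<^sup>2 * K x y)"
  proof (intro sum_mono)
    fix x y assume xy: "x \<in> T" "y \<in> T"
    have "c x * c y \<le> M * M"
      using c[OF xy(1)] c[OF xy(2)] by (intro mult_mono) auto
    then have "K x y * (c x * c y) \<le> K x y * (M * M)"
      using K[OF xy] by (rule mult_left_mono)
    then show "K x y * c x * c y \<le> M\<^sup>2 * K x y"
      by (simp add: power2_eq_square mult_ac)
  qed
  also have "\<dots> = M\<^sup>2 * (\<Sum>x\<in>T. \<Sum>y\<in>T. K x y)"
    by (simp add: sum_distrib_left)
  also have "\<dots> \<le> M\<^sup>2 * (real (card T) * G)"
    using G by (rule mult_left_mono) simp
  finally show ?thesis
    by (simp add: mult_ac)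
qed

text \<open>Level \<open>m\<close> is a catch-all without a lower bound. When \<open>m\<close> grows
  by one, either the old level satisfies its lower bound and is kept, or it was the catch-all and
  the failure of that bound moves \<open>a\<close> down to the new last level.\<close>

lemma exp_level_exists:
  fixes a D :: real
  assumes "0 \<le> a" "a \<le> D"
  shows "\<exists>i\<le>m. a \<le> D * exp (- real i) \<and> (i < m \<longrightarrow> D * exp (- real i - 1) \<le> a)"
proof (induction m)
  case 0
  then show ?case using assms by simp
next
  case (Suc m)
  then obtain i where i: "i \<le> m" "a \<le> D * exp (- real i)" "i < m \<longrightarrow> D * exp (- real i - 1) \<le> a"
    by blast
  show ?case
  proof (cases "D * exp (- real i - 1) \<le> a")
    case True
    then show ?thesis using i by (intro exI[of _ i]) auto
  next
    case False
    moreover from this have "i = m"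
      using i by auto
    moreover have "- real (Suc m) = - real m - 1"
      by simp
    ultimately show ?thesis
      by (intro exI[of _ "Suc m"]) (simp only:, simp)
  qed
qed

text \<open>The blocks above the last level together contribute \<open>e^2\<close>, the last one
  contributes 1, and the number of blocks gives the logarithmic factor.\<close>

lemma bform_le_log_card:
  assumes "finite S" "S \<noteq> {}" and psd: "psd_on S K"
    and K: "\<And>x y. x \<in> S \<Longrightarrow> y \<in> S \<Longrightarrow> 0 \<le> K x y"
    and c: "\<And>x. x \<in> S \<Longrightarrow> 0 \<le> c x"
    and G: "\<And>T. T \<subseteq> S \<Longrightarrow> (\<Sum>x\<in>T. \<Sum>y\<in>T. K x y) \<le> real (card T) * G"
  shows "bform S K c c
    \<le> ((exp 1)\<^sup>2 + 1) * (real_of_int \<lfloor>ln (real (card S))\<rfloor> + 2) * G * (\<Sum>x\<in>S. (c x)\<^sup>2)"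
proof -
  define N where "N = real (card S)"
  define D where "D = sqrt (\<Sum>x\<in>S. (c x)\<^sup>2)"
  \<comment> \<open>The levels \<open>0, ..., m\<close> number \<open>[log N] + 2\<close>, and
    \<open>m\<close> exceeds \<open>log N\<close>, so entries in the last level are at most
    \<open>D / N\<close>.\<close>
  define m where "m = nat (\<lfloor>ln N\<rfloor> + 1)"
  have "1 \<le> N"
    using assms(1,2) by (simp add: N_def Suc_le_eq card_gt_0_iff)
  then have "0 \<le> ln N"
    by simp
  then have m: "real m = real_of_int \<lfloor>ln N\<rfloor> + 1"
    by (simp add: m_def)
  have "D \<ge> 0" and D2: "D\<^sup>2 = (\<Sum>x\<in>S. (c x)\<^sup>2)"
    by (simp_all add: D_def sum_nonneg)
  have "G \<ge> 0"
  proof -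
    obtain x where "x \<in> S"
      using \<open>S \<noteq> {}\<close> by blast
    then show ?thesis
      using G[of "{x}"] K[of x x] by simp
  qed
  have "c x \<le> D" if "x \<in> S" for x
    unfolding D_def using \<open>finite S\<close> that
    by (intro real_le_rsqrt member_le_sum) auto
  then have "\<forall>x\<in>S. \<exists>i\<le>m. c x \<le> D * exp (- real i) \<and> (i < m \<longrightarrow> D * exp (- real i - 1) \<le> c x)"
    using c by (blast intro: exp_level_exists)
  then obtain lev where lev: "\<And>x. x \<in> S \<Longrightarrow> lev x \<le> m"
    and upper: "\<And>x. x \<in> S \<Longrightarrow> c x \<le> D * exp (- real (lev x))"
    and lower: "\<And>x. x \<in> S \<Longrightarrow> lev x < m \<Longrightarrow> D * exp (- real (lev x) - 1) \<le> c x"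
    by metis
  define T where "T i = {x \<in> S. lev x = i}" for i
  define v where "v i x = (if x \<in> T i then c x else 0)" for i x
  have T: "T i \<subseteq> S" "finite (T i)" for i
    using \<open>finite S\<close> by (auto simp: T_def)
  have block: "bform S K (v i) (v i) \<le> (D * exp (- real i))\<^sup>2 * real (card (T i)) * G" for i
    unfolding v_def by (rule bform_restrict_le) (use T \<open>finite S\<close> K c upper G in \<open>auto simp: T_def\<close>)
  \<comment> \<open>Here the upper bound of the level is exactly \<open>e\<close> times its lower
    bound, so passing from one to the other costs \<open>e^2\<close> after squaring.\<close>
  have top: "bform S K (v i) (v i) \<le> (exp 1)\<^sup>2 * G * (\<Sum>x\<in>T i. (c x)\<^sup>2)" if "i < m" for i
  proof -
    have "real (card (T i)) * (D * exp (- real i - 1))\<^sup>2 \<le> (\<Sum>x\<in>T i. (c x)\<^sup>2)"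
      using lower that \<open>D \<ge> 0\<close> by (intro sum_bounded_below power_mono) (auto simp: T_def)
    then have "(exp 1)\<^sup>2 * G * (real (card (T i)) * (D * exp (- real i - 1))\<^sup>2)
        \<le> (exp 1)\<^sup>2 * G * (\<Sum>x\<in>T i. (c x)\<^sup>2)"
      using \<open>G \<ge> 0\<close> by (intro mult_left_mono) auto
    moreover have "(D * exp (- real i))\<^sup>2 = (exp 1)\<^sup>2 * (D * exp (- real i - 1))\<^sup>2"
      by (simp add: exp_diff power_mult_distrib power_divide)
    ultimately show ?thesis
      using block[of i] by (simp only: mult_ac)
  qed
  \<comment> \<open>At most \<open>N\<close> entries, each of size at most \<open>D / N\<close>,
    have total square at most \<open>D^2 / N\<close>; the weaker bound \<open>D^2\<close>
    suffices.\<close>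
  have bottom: "bform S K (v m) (v m) \<le> G * D\<^sup>2"
  proof -
    have "N = exp (ln N)"
      using \<open>1 \<le> N\<close> by simp
    also have "\<dots> \<le> exp (real m)"
      using m by (simp only: exp_le_cancel_iff) linarith
    finally have "N \<le> exp (real m)" .
    then have "N * exp (- real m) \<le> 1"
      by (simp add: exp_minus field_simps)
    then have "(N * exp (- real m)) * exp (- real m) \<le> 1 * 1"
      using \<open>1 \<le> N\<close> by (intro mult_mono) auto
    moreover have "real (card (T m)) \<le> N"
      unfolding N_def using T \<open>finite S\<close> by (simp add: card_mono)
    ultimately have "real (card (T m)) * exp (- real m) * exp (- real m) \<le> 1"
      by (smt (verit) exp_gt_zero mult_right_mono)
    then have "real (card (T m)) * exp (- real m) * exp (- real m) * (G * D\<^sup>2) \<le> 1 * (G * D\<^sup>2)"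
      using \<open>G \<ge> 0\<close> by (intro mult_right_mono) auto
    then show ?thesis
      using block[of m] by (simp add: power2_eq_square mult_ac)
  qed
  have split: "(\<Sum>i\<le>m. v i x) = c x" if "x \<in> S" for x
    using lev[OF that] that by (simp add: v_def T_def)
  have "(\<Sum>i<m. \<Sum>x\<in>T i. (c x)\<^sup>2) \<le> (\<Sum>i\<le>m. \<Sum>x\<in>T i. (c x)\<^sup>2)"
    by (intro sum_mono2) (auto simp: sum_nonneg)
  also have "\<dots> = D\<^sup>2"
    unfolding D2 T_def using \<open>finite S\<close> lev by (intro sum.group) auto
  finally have parts: "(\<Sum>i<m. \<Sum>x\<in>T i. (c x)\<^sup>2) \<le> D\<^sup>2" .
  have "(\<Sum>i\<le>m. bform S K (v i) (v i)) = (\<Sum>i<m. bform S K (v i) (v i)) + bform S K (v m) (v m)"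
    by (simp flip: lessThan_Suc_atMost)
  also have "\<dots> \<le> (\<Sum>i<m. (exp 1)\<^sup>2 * G * (\<Sum>x\<in>T i. (c x)\<^sup>2)) + G * D\<^sup>2"
    using top bottom by (intro add_mono sum_mono) auto
  also have "\<dots> \<le> (exp 1)\<^sup>2 * G * D\<^sup>2 + G * D\<^sup>2"
    unfolding sum_distrib_left[symmetric]
    using parts \<open>G \<ge> 0\<close> by (intro add_right_mono mult_left_mono) auto
  finally have sum_le: "(\<Sum>i\<le>m. bform S K (v i) (v i)) \<le> ((exp 1)\<^sup>2 + 1) * G * D\<^sup>2"
    by (simp add: algebra_simps)
  have "bform S K c c = bform S K (\<lambda>x. \<Sum>i\<le>m. v i x) (\<lambda>x. \<Sum>i\<le>m. v i x)"
    by (simp add: bform_def split)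
  also have "\<dots> \<le> real (card {..m}) * (\<Sum>i\<le>m. bform S K (v i) (v i))"
    by (rule psd_on_bform_sum_le[OF psd])
  also have "\<dots> \<le> real (card {..m}) * (((exp 1)\<^sup>2 + 1) * G * D\<^sup>2)"
    using sum_le by (rule mult_left_mono) simp
  also have "real (card {..m}) = real_of_int \<lfloor>ln N\<rfloor> + 2"
    using m by simp
  finally show ?thesis
    by (simp add: D2 N_def mult_ac)
qed

section \<open>Passage to \<open>Gam\<close> and \<open>Lam\<close>\<close>

text \<open>Enumerating \<open>T\<close> by \<open>{1..n}\<close> turns the restriction of
  \<open>\<beta>\<close> into one of the distinct tuples over which the supremum
  \<open>Gam t n\<close> is taken.\<close>

lemma sum_le_card_times_Gam:
  assumes t: "\<And>j. 0 < t j \<and> t j < 1" and "finite T" "inj_on \<beta> T"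
  shows "(\<Sum>x\<in>T. \<Sum>y\<in>T. mpow t (absdiff (\<beta> x) (\<beta> y))) \<le> real (card T) * Gam t (card T)"
proof (cases "T = {}")
  case False
  define n where "n = card T"
  have "n > 0"
    using False \<open>finite T\<close> by (simp add: n_def card_gt_0_iff)
  obtain h where h: "bij_betw h {1..n} T"
    using \<open>finite T\<close> ex_bij_betw_nat_finite_1 unfolding n_def by blast
  have "inj_on (\<beta> \<circ> h) {1..n}"
    using h \<open>inj_on \<beta> T\<close> by (auto simp: bij_betw_def intro: comp_inj_on)
  then have "\<beta> \<circ> h \<in> distinct_tuples n"
    by (simp add: distinct_tuples_def)
  then have "(1 / real n) * (\<Sum>k=1..n. \<Sum>l=1..n. mpow t (absdiff ((\<beta> \<circ> h) k) ((\<beta> \<circ> h) l))) \<le> Gam t n"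
    unfolding Gam_def
    by (rule cSUP_upper) (rule bdd_aboveI2, rule Gam_quotient_le[OF t])
  moreover have "(\<Sum>x\<in>T. \<Sum>y\<in>T. mpow t (absdiff (\<beta> x) (\<beta> y)))
      = (\<Sum>k=1..n. \<Sum>l=1..n. mpow t (absdiff ((\<beta> \<circ> h) k) ((\<beta> \<circ> h) l)))"
    by (simp flip: sum.reindex_bij_betw[OF h])
  ultimately show ?thesis
    using \<open>n > 0\<close> by (simp add: field_simps flip: n_def)
qed simp

text \<open>The kernel entries are nonnegative, so the triangle inequality reduces complex vectors
  to nonnegative ones, as the level decomposition requires.\<close>

lemma Hermitian_form_le_bform_cmod:
  assumes "\<And>j. 0 < t j \<and> t j < 1"
  shows "Re (\<Sum>k\<in>S. \<Sum>l\<in>S. complex_of_real (mpow t (absdiff (\<beta> k) (\<beta> l))) * c k * cnj (c l))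
    \<le> bform S (\<lambda>k l. mpow t (absdiff (\<beta> k) (\<beta> l))) (\<lambda>k. cmod (c k)) (\<lambda>k. cmod (c k))"
  unfolding bform_def
  by (intro order_trans[OF complex_Re_le_cmod] sum_norm_le)
    (simp add: norm_mult mpow_bounds[OF assms])

theorem theorem5:
  fixes t :: "nat \<Rightarrow> real" and N :: nat
  assumes "decseq t"
    and "\<And>j. 0 < t j \<and> t j < 1"
    and "N \<ge> 1"
  shows "Lam t N \<le> ((exp 1)\<^sup>2 + 1) * (real_of_int \<lfloor>ln (real N)\<rfloor> + 2) * Max (Gam t ` {1..N})"
  unfolding Lam_def
proof (intro cSUP_least)
  note t = assms(2)
  show "distinct_tuples N \<noteq> {}" "nonzero_vectors N \<noteq> {}"
    using distinct_tuples_nonempty nonzero_vectors_nonempty \<open>N \<ge> 1\<close> by auto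
  fix \<beta> c assume \<beta>: "\<beta> \<in> distinct_tuples N" and c: "c \<in> nonzero_vectors N"
  let ?S = "{1..N}" and ?G = "Max (Gam t ` {1..N})"
  let ?C = "((exp 1)\<^sup>2 + 1) * (real_of_int \<lfloor>ln (real N)\<rfloor> + 2) * ?G"
  let ?K = "\<lambda>k l. mpow t (absdiff (\<beta> k) (\<beta> l))"
  \<comment> \<open>Blocks have unknown sizes between 1 and \<open>N\<close> when nonempty; the
    maximum of \<open>Gam\<close> over these sizes gives one constant valid for all of them.\<close>
  have G: "(\<Sum>x\<in>T. \<Sum>y\<in>T. ?K x y) \<le> real (card T) * ?G" if "T \<subseteq> ?S" for T
  proof (cases "T = {}")
    case False
    have "finite T" "inj_on \<beta> T"
      using that \<beta> finite_subset by (auto simp: distinct_tuples_def intro: inj_on_subset)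
    then have "(\<Sum>x\<in>T. \<Sum>y\<in>T. ?K x y) \<le> real (card T) * Gam t (card T)"
      by (intro sum_le_card_times_Gam t)
    moreover have "card T \<in> {1..N}"
      using False \<open>finite T\<close> card_mono[OF _ that] by (simp add: Suc_le_eq card_gt_0_iff)
    then have "Gam t (card T) \<le> ?G"
      by simp
    ultimately show ?thesis
      by (meson mult_left_mono of_nat_0_le_iff order_trans)
  qed simp
  have "Re (\<Sum>k\<in>?S. \<Sum>l\<in>?S. complex_of_real (?K k l) * c k * cnj (c l))
      \<le> bform ?S ?K (\<lambda>k. cmod (c k)) (\<lambda>k. cmod (c k))"
    by (rule Hermitian_form_le_bform_cmod[OF t])
  also have "\<dots> \<le> ((exp 1)\<^sup>2 + 1) * (real_of_int \<lfloor>ln (real (card ?S))\<rfloor> + 2) * ?G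
      * (\<Sum>k\<in>?S. (cmod (c k))\<^sup>2)"
    using \<open>N \<ge> 1\<close> G by (intro bform_le_log_card psd_on_mpow_absdiff t mpow_bounds) auto
  finally have "Re (\<Sum>k\<in>?S. \<Sum>l\<in>?S. complex_of_real (?K k l) * c k * cnj (c l))
      \<le> ?C * (\<Sum>k\<in>?S. (cmod (c k))\<^sup>2)"
    by simp
  moreover have "0 < (\<Sum>k\<in>?S. (cmod (c k))\<^sup>2)"
    using c unfolding nonzero_vectors_def by (auto intro: sum_pos2)
  ultimately show "Re (\<Sum>k\<in>?S. \<Sum>l\<in>?S. complex_of_real (?K k l) * c k * cnj (c l))
      / (\<Sum>k\<in>?S. (cmod (c k))\<^sup>2) \<le> ?C"
    by (simp add: pos_divide_le_eq)
qed

end
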